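(* Let $G$ be a left-filled graph with vertex set $[n]$. Then $L_G$ is a lattice, and $\Psi_G:\mathfrak{S}_n\to L_G$ is a join semilattice map; that is, for all $w,w'\in\mathfrak{S}_n$, $\Psi_G(w\vee w')=\Psi_G(w)\vee\Psi_G(w')$.
   Context: Write $[n]=\{1,\dots,n\}$; graphs are simple, and $G|_I$ is the induced subgraph on $I$. $G$ is left-filled if whenever $\{i,k\}$ is an edge and $i<j<k$, $\{i,j\}$ is an edge. A tube of $G$ is a nonempty $I\subseteq[n]$ with $G|_I$ connected. Tubes $I,J$ are compatible if they are nested or $I\cup J$ is not a tube. A maximal tubing is an inclusion-maximal set of pairwise compatible tubes. Each tube $I$ in a maximal tubing $\mathcal{X}$ contains a unique element $\mathrm{top}_{\mathcal{X}}(I)$ in no tube of $\mathcal{X}$ properly contained in $I$. If $\mathcal{Y}=(\mathcal{X}\setminus\{I\})\cup\{J\}$ are maximal tubings with $I\ne J$, write $\mathcal{X}\to\mathcal{Y}$ if $\mathrm{top}_{\mathcal{X}}(I)<\mathrm{top}_{\mathcal{Y}}(J)$; $L_G$ is the set of maximal tubings ordered by the reflexive transitive closure of $\to$. Weak order on $\mathfrak{S}_n$ (a lattice): $x\le y$ iff $\mathrm{inv}(x)\subseteq\mathrm{inv}(y)$, where $(i,k)$, $i<k$, is in $\mathrm{inv}(x)$ iff $k$ precedes $i$ in $x=x_1\cdots x_n$. $\Psi_G(w)$ is the maximal tubing $\{X_1,\dots,X_n\}$ where $X_j$ is the vertex set of the connected component of $G|_{\{w_1,\dots,w_j\}}$ containing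 $w_j$. *)

theory Defs
  imports
    "HOL-Algebra.Lattice"
    "HOL-Combinatorics.Permutations"
    "Graph_Theory.Graph_Theory"
begin

text \<open>
  A simple graph is a finite, loop-free, symmetric digraph without parallel arcs
  (locale \<^locale>\<open>pair_graph\<close>): an edge joining \<open>i\<close> and \<open>k\<close> is present as the two arcs
  \<open>(i, k)\<close> and \<open>(k, i)\<close>.
\<close>

definition left_filled :: "nat pair_pre_digraph \<Rightarrow> bool" where
  "left_filled G \<longleftrightarrow>
     (\<forall>i j k. (i, k) \<in> parcs G \<and> i < j \<and> j < k \<longrightarrow> (i, j) \<in> parcs G)"

section \<open>Maximal tubings\<close>

definition tube :: "nat pair_pre_digraph \<Rightarrow> nat set \<Rightarrow> bool" where
  "tube G I \<longleftrightarrow>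
     I \<noteq> {} \<and> I \<subseteq> pverts G \<and> Digraph_Component.connected (with_proj G \<restriction> I)"

definition compatible_tubes :: "nat pair_pre_digraph \<Rightarrow> nat set \<Rightarrow> nat set \<Rightarrow> bool" where
  "compatible_tubes G I J \<longleftrightarrow> I \<subseteq> J \<or> J \<subseteq> I \<or> \<not> tube G (I \<union> J)"

definition tubing :: "nat pair_pre_digraph \<Rightarrow> nat set set \<Rightarrow> bool" where
  "tubing G X \<longleftrightarrow> (\<forall>I\<in>X. tube G I) \<and> (\<forall>I\<in>X. \<forall>J\<in>X. compatible_tubes G I J)"

definition maximal_tubing :: "nat pair_pre_digraph \<Rightarrow> nat set set \<Rightarrow> bool" where
  "maximal_tubing G X \<longleftrightarrow> tubing G X \<and> (\<forall>Y. tubing G Y \<and> X \<subseteq> Y \<longrightarrow> Y = X)"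

definition tube_top :: "nat set set \<Rightarrow> nat set \<Rightarrow> nat" where
  "tube_top X I = (THE i. i \<in> I \<and> (\<forall>J\<in>X. J \<subset> I \<longrightarrow> i \<notin> J))"

definition flip :: "nat pair_pre_digraph \<Rightarrow> nat set set rel" where
  "flip G = {(X, Y). maximal_tubing G X \<and> maximal_tubing G Y \<and>
     (\<exists>I J. I \<in> X \<and> I \<noteq> J \<and> Y = (X - {I}) \<union> {J} \<and> tube_top X I < tube_top Y J)}"

definition tubing_order :: "nat pair_pre_digraph \<Rightarrow> nat set set gorder" where
  "tubing_order G =
     \<lparr>carrier = {X. maximal_tubing G X}, eq = (=), le = (\<lambda>X Y. (X, Y) \<in> (flip G)\<^sup>*)\<rparr>"

section \<open>The weak order\<close>

text \<open>
  A permutation \<open>w\<close> of \<open>{1..n}\<close> has the one-line notation \<open>w 1, w 2, \<dots>, w n\<close>.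
  Inversions are pairs of values, not of positions.
\<close>

definition inversions :: "nat \<Rightarrow> (nat \<Rightarrow> nat) \<Rightarrow> (nat \<times> nat) set" where
  "inversions n w =
     {(i, k). i < k \<and> (\<exists>a b. 1 \<le> a \<and> a < b \<and> b \<le> n \<and> w a = k \<and> w b = i)}"

definition weak_order :: "nat \<Rightarrow> (nat \<Rightarrow> nat) gorder" where
  "weak_order n =
     \<lparr>carrier = {w. w permutes {1..n}}, eq = (=),
      le = (\<lambda>v w. inversions n v \<subseteq> inversions n w)\<rparr>"

text \<open>
  The arcs of \<open>G\<close> being symmetric, the strongly connected component of a vertex in an induced
  subgraph is the vertex set of its connected component.
\<close>

definition Psi :: "nat \<Rightarrow> nat pair_pre_digraph \<Rightarrow> (nat \<Rightarrow> nat) \<Rightarrow> nat set set" where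
  "Psi n G w = (\<lambda>j. pre_digraph.scc_of (with_proj G \<restriction> (w ` {1..j})) (w j)) ` {1..n}"

end

theory Submission
  imports Defs
begin

text \<open>
  For a maximal tubing \<open>X\<close> let \<open>X\<^sub>k\<close> be its least tube containing \<open>k\<close>; then \<open>k \<mapsto> X\<^sub>k\<close> is a
  bijection onto \<open>X\<close>, inverse to \<open>top\<close>, and the fibre of \<open>\<Psi>\<close> over \<open>X\<close> consists of the linear
  extensions of the forest order \<open>i \<in> X\<^sub>k\<close>. If \<open>G\<close> is left-filled, the set \<open>N(X)\<close> of pairs \<open>i < k\<close>
  with \<open>i \<in> X\<^sub>k\<close> and its complement are both transitive, so the fibre has a greatest element,
  whose noninversions are exactly \<open>N(X)\<close>. A flip \<open>X \<rightarrow> Y\<close> satisfies \<open>N(Y) \<subseteq> N(X)\<close>, and \<open>\<Psi>\<close> is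
  order preserving because an adjacent transposition either fixes \<open>\<Psi>\<close> or induces a flip. Hence
  \<open>\<Psi>\<close> is a surjective left adjoint, which yields the lattice property and the preservation of
  joins.
\<close>

section \<open>Bounds of a pair of elements\<close>

lemma Upper_pair:
  "x \<in> carrier L \<Longrightarrow> y \<in> carrier L \<Longrightarrow>
    u \<in> Upper L {x, y} \<longleftrightarrow> u \<in> carrier L \<and> x \<sqsubseteq>\<^bsub>L\<^esub> u \<and> y \<sqsubseteq>\<^bsub>L\<^esub> u"
  unfolding Upper_def by auto

lemma Lower_pair:
  "x \<in> carrier L \<Longrightarrow> y \<in> carrier L \<Longrightarrow>
    u \<in> Lower L {x, y} \<longleftrightarrow> u \<in> carrier L \<and> u \<sqsubseteq>\<^bsub>L\<^esub> x \<and> u \<sqsubseteq>\<^bsub>L\<^esub> y"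
  unfolding Lower_def by auto

section \<open>Connectivity\<close>

text \<open>Walks in \<open>rtrancl_on I E\<close> stay inside \<open>I\<close>, so for symmetric
  \<open>E\<close> this is connectedness of the induced subgraph without forming it; the empty set
  is excluded, as for tubes.\<close>

definition connected_on :: "'a rel \<Rightarrow> 'a set \<Rightarrow> bool" where
  "connected_on E I \<longleftrightarrow> I \<noteq> {} \<and> (\<forall>u\<in>I. \<forall>v\<in>I. (u, v) \<in> rtrancl_on I E)"

definition component :: "'a rel \<Rightarrow> 'a set \<Rightarrow> 'a \<Rightarrow> 'a set" where
  "component E S v = {u. (v, u) \<in> rtrancl_on S E}"

lemma rtrancl_on_mono_dom:
  assumes "(u, v) \<in> rtrancl_on S E" "S \<subseteq> T"
  shows "(u, v) \<in> rtrancl_on T E"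
  using assms(1)
  by (induct rule: rtrancl_on_induct) (use assms(2) in \<open>auto intro: rtrancl_on_into_rtrancl_on\<close>)

lemma rtrancl_on_sym:
  assumes "(u, v) \<in> rtrancl_on S E" "sym E"
  shows "(v, u) \<in> rtrancl_on S E"
  using rtrancl_on_converseI[OF assms(1)] assms(2) by (simp add: sym_conv_converse_eq)

text \<open>Some step of the walk leaves \<open>A\<close>. Later arguments take \<open>A\<close> to
  be a tube, a component or an initial segment of the vertices and then examine that edge.\<close>

lemma rtrancl_on_crossing:
  assumes "(u, v) \<in> rtrancl_on S E" "u \<in> A" "v \<notin> A"
  shows "\<exists>p q. p \<in> A \<inter> S \<and> q \<in> S - A \<and> (p, q) \<in> E"
  using assms by (induct arbitrary: rule: rtrancl_on_induct) auto

lemma connected_on_crossing: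
  assumes "connected_on E I" "u \<in> I" "u \<in> A" "v \<in> I" "v \<notin> A"
  shows "\<exists>p q. p \<in> A \<inter> I \<and> q \<in> I - A \<and> (p, q) \<in> E"
  using assms rtrancl_on_crossing[of u v I E A] unfolding connected_on_def by blast

lemma connected_on_Un:
  assumes "connected_on E I" "connected_on E J" "x \<in> I" "x \<in> J"
  shows "connected_on E (I \<union> J)"
proof -
  have to_x: "(u, x) \<in> rtrancl_on (I \<union> J) E \<and> (x, u) \<in> rtrancl_on (I \<union> J) E"
    if "u \<in> I \<union> J" for u
  proof (cases "u \<in> I")
    case True
    then show ?thesis
      using assms(1,3) rtrancl_on_mono_dom[of _ _ I E "I \<union> J"] unfolding connected_on_def by simp
  next
    case False
    then show ?thesis
      using that assms(2,4) rtrancl_on_mono_dom[of _ _ J E "I \<union> J"] unfolding connected_on_def by simp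
  qed
  have "(u, v) \<in> rtrancl_on (I \<union> J) E" if "u \<in> I \<union> J" "v \<in> I \<union> J" for u v
    using rtrancl_on_trans to_x[OF that(1)] to_x[OF that(2)] by metis
  then show ?thesis
    using assms(3) unfolding connected_on_def by blast
qed

lemma connected_on_edge:
  assumes "sym E" "(x, y) \<in> E"
  shows "connected_on E {x, y}"
  using assms unfolding connected_on_def sym_def
  by (auto intro: rtrancl_on_into_rtrancl_on[OF rtrancl_on_refl])

lemma connected_on_Un_edge:
  assumes "sym E" "connected_on E I" "connected_on E J" "x \<in> I" "y \<in> J" "(x, y) \<in> E"
  shows "connected_on E (I \<union> J)"
proof -
  have "connected_on E ((I \<union> {x, y}) \<union> J)"
    using assms by (intro connected_on_Un[where x = y] connected_on_Un[where x = x] connected_on_edge) auto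
  moreover have "(I \<union> {x, y}) \<union> J = I \<union> J" using assms by auto
  ultimately show ?thesis by simp
qed

lemma component_subset: "component E S v \<subseteq> S"
  unfolding component_def by (auto dest: in_rtrancl_on_in_F)

lemma component_self: "v \<in> S \<Longrightarrow> v \<in> component E S v"
  unfolding component_def by auto

lemma component_absorb_edge:
  assumes "x \<in> component E S v" "(x, y) \<in> E" "y \<in> S"
  shows "y \<in> component E S v"
  using assms unfolding component_def by (auto intro: rtrancl_on_into_rtrancl_on)

lemma component_absorb:
  assumes "connected_on E K" "K \<subseteq> S" "x \<in> K" "x \<in> component E S v"
  shows "K \<subseteq> component E S v"
proof
  fix y
  assume "y \<in> K"
  then have "(x, y) \<in> rtrancl_on S E"
    using assms rtrancl_on_mono_dom[of x y K E S] unfolding connected_on_def by blast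
  then show "y \<in> component E S v"
    using assms(4) rtrancl_on_trans[of v x S E y] unfolding component_def by blast
qed

lemma component_connected:
  assumes "sym E" "v \<in> S"
  shows "connected_on E (component E S v)"
proof -
  let ?C = "component E S v"
  \<comment> \<open>Connectedness has to be witnessed inside the component, not merely inside
    \<open>S\<close>: every vertex of a walk from \<open>v\<close> within \<open>S\<close> lies in
    the component.\<close>
  have *: "(v, u) \<in> rtrancl_on ?C E" if "u \<in> ?C" for u
  proof -
    have "(v, u) \<in> rtrancl_on S E" using that by (simp add: component_def)
    then show ?thesis
    proof (induct rule: rtrancl_on_induct)
      case base
      then show ?case using component_self[OF assms(2)] by auto
    next
      case (step y z)
      then have "z \<in> ?C" unfolding component_def by (auto intro: rtrancl_on_into_rtrancl_on)
      with step show ?case by (auto intro: rtrancl_on_into_rtrancl_on)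
    qed
  qed
  then show ?thesis
    using component_self[OF assms(2)] assms(1) unfolding connected_on_def
    by (metis empty_iff rtrancl_on_trans rtrancl_on_sym)
qed

lemma component_cong:
  assumes "sym E" "u \<in> component E S v"
  shows "component E S u = component E S v"
proof -
  have uv: "(v, u) \<in> rtrancl_on S E" "(u, v) \<in> rtrancl_on S E"
    using assms rtrancl_on_sym[of v u S E] by (simp_all add: component_def)
  then show ?thesis
    unfolding component_def by (auto dest: rtrancl_on_trans[OF uv(1)] rtrancl_on_trans[OF uv(2)])
qed

text \<open>The component misses \<open>x\<close>, so it remains a connected subset of the smaller
  set and is absorbed there. This compares prefixes of a word before and after an adjacent
  swap.\<close>

lemma component_Diff:
  assumes "x \<notin> component E S v" "v \<in> S" "sym E"
  shows "component E (S - {x}) v = component E S v"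
proof
  show "component E (S - {x}) v \<subseteq> component E S v"
    unfolding component_def by (auto elim: rtrancl_on_mono_dom)
  have "v \<in> S - {x}" using assms component_self[OF assms(2)] by blast
  moreover have "component E S v \<subseteq> S - {x}"
    using component_subset[of E S v] assms(1) by blast
  ultimately show "component E S v \<subseteq> component E (S - {x}) v"
    using component_absorb[OF component_connected[OF assms(3,2)]] component_self assms(2) by metis
qed

lemma trancl_subset_trans: "A \<subseteq> B \<Longrightarrow> trans B \<Longrightarrow> A\<^sup>+ \<subseteq> B"
  using trancl_mono[of _ A B] trancl_id[of B] by auto

section \<open>Permutations and their inversion sets\<close>

text \<open>
  Only triples \<open>i < j < k\<close> matter: the sets in question consist of increasing pairs, where this
  says that \<open>A\<close> and its complement are transitive.
\<close>

definition biclosed :: "nat rel \<Rightarrow> bool" where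
  "biclosed A \<longleftrightarrow> (\<forall>i j k. i < j \<and> j < k \<longrightarrow>
     ((i, j) \<in> A \<and> (j, k) \<in> A \<longrightarrow> (i, k) \<in> A) \<and> ((i, k) \<in> A \<longrightarrow> (i, j) \<in> A \<or> (j, k) \<in> A))"

text \<open>The inversion set of the decreasing word, the largest possible one; complements are
  taken within it.\<close>

definition increasing_pairs :: "nat \<Rightarrow> nat rel" where
  "increasing_pairs n = {(i, k). 1 \<le> i \<and> i < k \<and> k \<le> n}"

text \<open>\<open>inv w x\<close> is the position of the value \<open>x\<close> in the word
  \<open>w\<close>, so inversions become comparisons of positions.\<close>

lemma inversions_iff:
  assumes "w permutes {1..n}"
  shows "(i, k) \<in> inversions n w \<longleftrightarrow>
    i < k \<and> i \<in> {1..n} \<and> k \<in> {1..n} \<and> inv w k < inv w i"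
proof -
  have "inv w x \<in> {1..n} \<longleftrightarrow> x \<in> {1..n}" for x
    using permutes_in_image[OF permutes_inv[OF assms]] .
  moreover have "w a = x \<longleftrightarrow> a = inv w x" for a x
    using permutes_inv_eq[OF assms] by metis
  ultimately show ?thesis unfolding inversions_def
    by simp (metis One_nat_def atLeastAtMost_iff less_imp_le le_trans)
qed

lemma inv_perm_inj:
  assumes "w permutes {1..n}"
  shows "inv w x = inv w y \<longleftrightarrow> x = y"
  using permutes_inverses(1)[OF assms] by metis

lemma inversions_subset: "w permutes {1..n} \<Longrightarrow> inversions n w \<subseteq> increasing_pairs n"
  by (auto simp: inversions_iff increasing_pairs_def)

lemma finite_increasing_pairs: "finite (increasing_pairs n)"
  by (rule finite_subset[of _ "{1..n} \<times> {1..n}"]) (auto simp: increasing_pairs_def)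

lemma biclosed_inversions:
  assumes "w permutes {1..n}"
  shows "biclosed (inversions n w)"
  unfolding biclosed_def by (auto simp: inversions_iff[OF assms])

text \<open>Complementation exchanges the two clauses of \<open>biclosed\<close>; this converts
  noninversion sets into inversion sets.\<close>

lemma biclosed_Diff:
  assumes "biclosed A"
  shows "biclosed (increasing_pairs n - A)"
  unfolding biclosed_def
proof (intro allI impI)
  fix i j k :: nat
  assume "i < j \<and> j < k"
  then show "((i, j) \<in> increasing_pairs n - A \<and> (j, k) \<in> increasing_pairs n - A \<longrightarrow>
        (i, k) \<in> increasing_pairs n - A) \<and>
      ((i, k) \<in> increasing_pairs n - A \<longrightarrow>
        (i, j) \<in> increasing_pairs n - A \<or> (j, k) \<in> increasing_pairs n - A)"
    using assms[unfolded biclosed_def, rule_format, of i j k]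
    by (auto simp: increasing_pairs_def)
qed

text \<open>For inversion sets this closure is the inversion set of the weak-order join. For the
  second clause, follow a chain from \<open>i\<close> to \<open>k\<close>: the value
  \<open>j\<close> is either met by the chain or jumped over by one link, and that link, lying in
  \<open>A\<close> or \<open>B\<close>, splits at \<open>j\<close>.\<close>

lemma biclosed_trancl_Un:
  assumes "biclosed A" "biclosed B"
  shows "biclosed ((A \<union> B)\<^sup>+)"
proof -
  have split: "(i, j) \<in> (A \<union> B)\<^sup>+ \<or> (j, k) \<in> (A \<union> B)\<^sup>+"
    if "(i, k) \<in> (A \<union> B)\<^sup>+" "i < j" "j < k" for i j k
    using that
  proof (induct rule: trancl_induct)
    case (base k)
    then show ?case using assms unfolding biclosed_def by blast
  next
    case (step y z)
    consider "j < y" | "j = y" | "y < j" by linarith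
    then show ?case
    proof cases
      case 1
      with step show ?thesis by (meson trancl.trancl_into_trancl)
    next
      case 2
      with step show ?thesis by blast
    next
      case 3
      then have "(y, j) \<in> A \<union> B \<or> (j, z) \<in> A \<union> B"
        using step assms unfolding biclosed_def by blast
      with step show ?thesis by (meson trancl.trancl_into_trancl r_into_trancl)
    qed
  qed
  then show ?thesis unfolding biclosed_def by (blast intro: trancl_trans)
qed

lemma trans_biclosed:
  assumes "biclosed A" "A \<subseteq> increasing_pairs n"
  shows "trans A"
proof (rule transI)
  fix i j k
  assume ij: "(i, j) \<in> A" and jk: "(j, k) \<in> A"
  then have "i < j" "j < k" using assms(2) unfolding increasing_pairs_def by auto
  then show "(i, k) \<in> A" using ij jk assms(1) unfolding biclosed_def by blast
qed

lemma trancl_increasing_pairs: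
  assumes "A \<subseteq> increasing_pairs n"
  shows "A\<^sup>+ \<subseteq> increasing_pairs n"
  using assms by (rule trancl_subset_trans) (auto simp: increasing_pairs_def trans_def)

text \<open>Let \<open>prec\<close> keep the natural order of pairs outside \<open>A\<close> and
  reverse those in \<open>A\<close>. The clauses of \<open>biclosed\<close> make it transitive,
  hence a linear order, and ranks in this order are the positions in the word.\<close>

lemma ex_permutation_inversions:
  assumes "biclosed A" "A \<subseteq> increasing_pairs n"
  shows "\<exists>w. w permutes {1..n} \<and> inversions n w = A"
proof -
  define prec where "prec a b \<longleftrightarrow> a < b \<and> (a, b) \<notin> A \<or> b < a \<and> (b, a) \<in> A" for a b
  have total: "prec a b \<or> prec b a" if "a \<noteq> b" for a b
    using that unfolding prec_def by auto
  have asym: "\<not> prec b a" if "prec a b" for a b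
    using that unfolding prec_def by auto
  have trans: "prec a c" if ab: "prec a b" and bc: "prec b c" for a b c
  proof -
    have ne: "a \<noteq> b" "b \<noteq> c" "a \<noteq> c" using ab bc asym unfolding prec_def by auto
    have 1: "(i, j) \<in> A \<Longrightarrow> (j, k) \<in> A \<Longrightarrow> (i, k) \<in> A" if "i < j" "j < k" for i j k
      using assms(1) that unfolding biclosed_def by blast
    have 2: "(i, k) \<in> A \<Longrightarrow> (i, j) \<in> A \<or> (j, k) \<in> A" if "i < j" "j < k" for i j k
      using assms(1) that unfolding biclosed_def by blast
    \<comment> \<open>For each relative size of the three values, one clause of
      \<open>biclosed\<close>, applied to the sorted triple, settles the claim.\<close>
    consider "a < b" "b < c" | "a < c" "c < b" | "b < a" "a < c"
      | "b < c" "c < a" | "c < a" "a < b" | "c < b" "b < a"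
      using ne by linarith
    then show ?thesis
      using ab bc 1 2 unfolding prec_def by cases (metis less_asym less_trans)+
  qed
  \<comment> \<open>Each \<open>k\<close> counts itself, so ranks start at 1; being the identity off
    \<open>{1..n}\<close> is what \<open>permutes\<close> demands. As \<open>pos\<close> sends
    values to positions, the word is its inverse.\<close>
  define pos where "pos k = (if k \<in> {1..n} then card {i \<in> {1..n}. i = k \<or> prec i k} else k)" for k
  have mono: "pos a < pos b" if "prec a b" "a \<in> {1..n}" "b \<in> {1..n}" for a b
  proof -
    have "{i \<in> {1..n}. i = a \<or> prec i a} \<subset> {i \<in> {1..n}. i = b \<or> prec i b}"
    proof
      show "{i \<in> {1..n}. i = a \<or> prec i a} \<subseteq> {i \<in> {1..n}. i = b \<or> prec i b}"
        using that trans by auto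
      have "b \<notin> {i \<in> {1..n}. i = a \<or> prec i a}" using that asym by auto
      then show "{i \<in> {1..n}. i = a \<or> prec i a} \<noteq> {i \<in> {1..n}. i = b \<or> prec i b}"
        using that by blast
    qed
    then have "card {i \<in> {1..n}. i = a \<or> prec i a} < card {i \<in> {1..n}. i = b \<or> prec i b}"
      by (intro psubset_card_mono) auto
    then show ?thesis using that unfolding pos_def by simp
  qed
  have iff: "pos a < pos b \<longleftrightarrow> prec a b" if "a \<in> {1..n}" "b \<in> {1..n}" for a b
    using that mono total by (metis less_asym less_irrefl)
  have range: "pos a \<in> {1..n}" if "a \<in> {1..n}" for a
  proof -
    have "card {i \<in> {1..n}. i = a \<or> prec i a} \<le> card {1..n}" by (intro card_mono) auto
    moreover have "card {i \<in> {1..n}. i = a \<or> prec i a} \<noteq> 0"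
      using that by (subst card_eq_0_iff) auto
    ultimately show ?thesis using that unfolding pos_def by (simp add: Suc_le_eq card_gt_0_iff)
  qed
  have "inj_on pos {1..n}"
    by (rule inj_onI) (metis mono total less_irrefl)
  then have "bij_betw pos {1..n} {1..n}"
    using endo_inj_surj[of "{1..n}" pos] range unfolding bij_betw_def by blast
  then have perm: "pos permutes {1..n}"
    by (rule bij_imp_permutes) (auto simp: pos_def)
  have "inversions n (inv pos) = A"
    using assms(2) unfolding increasing_pairs_def
    by (auto simp: inversions_iff[OF permutes_inv[OF perm]] permutes_inv_inv[OF perm] iff prec_def)
  then show ?thesis using permutes_inv[OF perm] by blast
qed

text \<open>Otherwise consecutive entries of \<open>v\<close> occur in the same order in
  \<open>w\<close>: ascents by assumption, descents because they are inversions of \<open>v\<close>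
  and so of \<open>w\<close>. Then \<open>inv w \<circ> v\<close> is strictly increasing on
  \<open>{1..n}\<close>, which forces \<open>v = w\<close>.\<close>

lemma ex_ascent:
  assumes v: "v permutes {1..n}" and w: "w permutes {1..n}"
    and le: "inversions n v \<subseteq> inversions n w" and ne: "v \<noteq> w"
  shows "\<exists>j. 1 \<le> j \<and> j < n \<and> v j < v (Suc j) \<and> (v j, v (Suc j)) \<in> inversions n w"
proof (rule ccontr)
  assume contra: "\<not> ?thesis"
  let ?g = "inv w \<circ> v"
  have g: "?g permutes {1..n}" using permutes_compose[OF v permutes_inv[OF w]] .
  have inc: "?g j < ?g (Suc j)" if j: "1 \<le> j" "j < n" for j
  proof -
    have mem: "v j \<in> {1..n}" "v (Suc j) \<in> {1..n}"
      unfolding permutes_in_image[OF v] using j by auto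
    have "v j \<noteq> v (Suc j)" by (simp add: inj_eq[OF permutes_inj[OF v]])
    then consider "v j < v (Suc j)" | "v (Suc j) < v j" by linarith
    then show ?thesis
    proof cases
      case 1
      then have "\<not> inv w (v (Suc j)) < inv w (v j)"
        using contra j mem inversions_iff[OF w] by blast
      then show ?thesis
        using \<open>v j \<noteq> v (Suc j)\<close> inv_perm_inj[OF w, of "v j" "v (Suc j)"] by auto
    next
      case 2
      then have "(v (Suc j), v j) \<in> inversions n v"
        using mem by (simp add: inversions_iff[OF v] permutes_inverses[OF v])
      then show ?thesis using le inversions_iff[OF w] by auto
    qed
  qed
  \<comment> \<open>A strictly increasing self-map of \<open>{1..n}\<close> never falls below the
    identity, and a permutation with this property is the identity.\<close>
  have "j \<in> {1..n} \<Longrightarrow> j \<le> ?g j" for j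
  proof (induct j)
    case (Suc j)
    show ?case
    proof (cases "j = 0")
      case True
      then show ?thesis using Suc permutes_in_image[OF g, of 1] by auto
    next
      case False
      then show ?thesis using Suc inc[of j] by auto
    qed
  qed auto
  then have "?g = id" by (intro permutes_natset_ge[OF g]) auto
  then have "v = w" by (metis comp_apply id_apply permutes_inverses(1)[OF w] ext)
  with ne show False by simp
qed

lemma inversions_adjacent_transposition:
  assumes v: "v permutes {1..n}" and j: "1 \<le> j" "j < n" "v j < v (Suc j)"
  shows "inversions n (v \<circ> transpose j (Suc j)) = insert (v j, v (Suc j)) (inversions n v)"
proof -
  let ?t = "transpose j (Suc j)"
  have t: "?t permutes {1..n}" using j by (intro permutes_swap_id) auto
  have vt: "v \<circ> ?t permutes {1..n}" using permutes_compose[OF t v] .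
  have inv: "inv (v \<circ> ?t) x = ?t (inv v x)" for x
    unfolding permutes_inv_eq[OF vt] by (simp add: permutes_inverses[OF v])
  have mem: "v j \<in> {1..n}" "v (Suc j) \<in> {1..n}"
    unfolding permutes_in_image[OF v] using j by auto
  \<comment> \<open>Swapping two adjacent positions reverses the comparison of that one pair and
    preserves all others.\<close>
  have less: "?t p < ?t q \<longleftrightarrow> (p < q \<and> \<not> (p = j \<and> q = Suc j)) \<or> (p = Suc j \<and> q = j)" for p q
    unfolding transpose_def by auto
  have eq: "inv v x = p \<longleftrightarrow> x = v p" for x p
    using permutes_inv_eq[OF v] by metis
  have "(i, k) \<in> inversions n (v \<circ> ?t) \<longleftrightarrow> (i, k) \<in> insert (v j, v (Suc j)) (inversions n v)" for i k
  proof -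
    have "(i, k) \<in> inversions n (v \<circ> ?t) \<longleftrightarrow> i < k \<and> i \<in> {1..n} \<and> k \<in> {1..n} \<and>
      (inv v k < inv v i \<and> \<not> (k = v j \<and> i = v (Suc j)) \<or> k = v (Suc j) \<and> i = v j)"
      unfolding inversions_iff[OF vt] inv less eq ..
    also have "\<dots> \<longleftrightarrow> (i, k) \<in> insert (v j, v (Suc j)) (inversions n v)"
      unfolding insert_iff inversions_iff[OF v] prod.inject using mem j(3) by (metis less_asym)
    finally show ?thesis .
  qed
  then show ?thesis by auto
qed

section \<open>Tubings\<close>

text \<open>In a tubing the tubes through \<open>v\<close> form a chain, so the intersection is
  itself a tube of the tubing; if there is none, the value is \<open>UNIV\<close>.\<close>

definition least_tube :: "nat set set \<Rightarrow> nat \<Rightarrow> nat set" where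
  "least_tube X v = \<Inter>{I \<in> X. v \<in> I}"

lemma least_tube_subset: "I \<in> X \<Longrightarrow> v \<in> I \<Longrightarrow> least_tube X v \<subseteq> I"
  unfolding least_tube_def by blast

lemma least_tube_eqI:
  assumes "I \<in> X" "v \<in> I" "\<And>J. J \<in> X \<Longrightarrow> v \<in> J \<Longrightarrow> I \<subseteq> J"
  shows "least_tube X v = I"
  using assms unfolding least_tube_def by blast

locale graph_on =
  fixes n :: nat and G :: "nat pair_pre_digraph"
  assumes graph: "pair_graph G" and verts: "pverts G = {1..n}"
begin

abbreviation E :: "nat rel" where "E \<equiv> parcs G"

lemma sym_E: "sym E"
proof -
  interpret pair_graph G by (rule graph)
  show ?thesis using pair_sym_arcs unfolding symmetric_def by simp
qed

lemma rtrancl_on_restrict: "rtrancl_on S (E \<inter> S \<times> S) = rtrancl_on S E"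
proof (intro equalityI subrelI)
  fix u v
  show "(u, v) \<in> rtrancl_on S E" if "(u, v) \<in> rtrancl_on S (E \<inter> S \<times> S)"
    using that by (induct rule: rtrancl_on_induct) (auto intro: rtrancl_on_into_rtrancl_on)
  show "(u, v) \<in> rtrancl_on S (E \<inter> S \<times> S)" if "(u, v) \<in> rtrancl_on S E"
    using that by (induct rule: rtrancl_on_induct) (auto intro: rtrancl_on_into_rtrancl_on)
qed

lemma arcs_ends_restrict: "arcs_ends (with_proj G \<restriction> S) = E \<inter> S \<times> S"
  by (auto simp: arcs_ends_conv)

lemma tube_iff: "tube G I \<longleftrightarrow> I \<subseteq> {1..n} \<and> connected_on E I"
proof -
  \<comment> \<open>The library's \<open>connected\<close> means strong connectedness of the
    symmetric closure, and for symmetric arcs that closure adds nothing.\<close>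
  let ?H = "with_proj (mk_symmetric (with_proj G \<restriction> I))"
  have "arcs_ends ?H = E \<inter> I \<times> I"
    unfolding mk_symmetric_def by (auto dest: symD[OF sym_E])
  moreover have "verts ?H = I"
    unfolding mk_symmetric_def by simp
  ultimately have "Digraph_Component.connected (with_proj G \<restriction> I) \<longleftrightarrow> connected_on E I"
    unfolding Digraph_Component.connected_def strongly_connected_def connected_on_def
      reachable_def rtrancl_on_restrict[symmetric, of I] by simp
  then show ?thesis unfolding tube_def verts connected_on_def by auto
qed

lemma scc_of_eq_component:
  "pre_digraph.scc_of (with_proj G \<restriction> S) v = component E S v"
  unfolding pre_digraph.scc_of_def reachable_def arcs_ends_restrict component_def
    induce_subgraph_verts rtrancl_on_restrict
  using rtrancl_on_sym[OF _ sym_E] by blast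

lemma tube_component: "S \<subseteq> {1..n} \<Longrightarrow> v \<in> S \<Longrightarrow> tube G (component E S v)"
  unfolding tube_iff
  using component_connected[OF sym_E, of v S] component_subset[of E S v] by simp

lemma tube_Un: "tube G I \<Longrightarrow> tube G J \<Longrightarrow> x \<in> I \<Longrightarrow> x \<in> J \<Longrightarrow> tube G (I \<union> J)"
  unfolding tube_iff using connected_on_Un[of E I J x] by simp

lemma tubingD:
  assumes "tubing G X" "I \<in> X"
  shows "tube G I" "I \<subseteq> {1..n}" "I \<noteq> {}" "finite I"
proof -
  show 1: "tube G I" using assms unfolding tubing_def by blast
  then show 2: "I \<subseteq> {1..n}" and "I \<noteq> {}" unfolding tube_iff connected_on_def by auto
  show "finite I" using 2 finite_subset by blast
qed

lemma tubing_nested: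
  assumes "tubing G X" "I \<in> X" "J \<in> X" "x \<in> I" "x \<in> J"
  shows "I \<subseteq> J \<or> J \<subseteq> I"
  using assms tube_Un[of I J x] unfolding tubing_def compatible_tubes_def by blast

text \<open>Compatibility also rules out disjoint tubes joined by an edge, since their union would
  be connected.\<close>

lemma tubing_nested_edge:
  assumes "tubing G X" "I \<in> X" "J \<in> X" "x \<in> I" "y \<in> J" "(x, y) \<in> E"
  shows "I \<subseteq> J \<or> J \<subseteq> I"
proof -
  have "tube G I" "tube G J" using assms tubingD by blast+
  then have "tube G (I \<union> J)"
    unfolding tube_iff using connected_on_Un_edge[OF sym_E _ _ assms(4-6)] by auto
  then show ?thesis using assms(1-3) unfolding tubing_def compatible_tubes_def by blast
qed

lemma finite_tubing: "tubing G X \<Longrightarrow> finite X"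
  using tubingD(2) by (intro finite_subset[of X "Pow {1..n}"]) auto

lemma least_tube_mem:
  assumes X: "tubing G X" and I: "I \<in> X" "v \<in> I"
  shows "least_tube X v \<in> X" "v \<in> least_tube X v"
proof -
  show "v \<in> least_tube X v" unfolding least_tube_def by blast
  \<comment> \<open>A tube of minimum cardinality through \<open>v\<close> lies inside every other
    one, by nestedness.\<close>
  have "\<exists>J. (J \<in> X \<and> v \<in> J) \<and> (\<forall>K. K \<in> X \<and> v \<in> K \<longrightarrow> card J \<le> card K)"
    using ex_has_least_nat[of "\<lambda>J. J \<in> X \<and> v \<in> J" I card] I by blast
  then obtain J where J: "J \<in> X" "v \<in> J" and min: "\<And>K. K \<in> X \<Longrightarrow> v \<in> K \<Longrightarrow> card J \<le> card K"
    by blast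
  have "least_tube X v = J"
  proof (rule least_tube_eqI[OF J])
    fix K
    assume K: "K \<in> X" "v \<in> K"
    show "J \<subseteq> K"
      using tubing_nested[OF X J(1) K(1) J(2) K(2)] min[OF K] card_seteq[of J K]
        tubingD(4)[OF X J(1)] by blast
  qed
  with J show "least_tube X v \<in> X" by simp
qed

text \<open>Suppose every vertex of \<open>I\<close> lies in a smaller tube, and take a largest tube
  \<open>J\<close> properly inside \<open>I\<close>. An edge leaves \<open>J\<close> towards some
  \<open>q\<close> in \<open>I\<close>; the least tube of \<open>q\<close> is adjacent to
  \<open>J\<close>, hence nested with it, and properly contains it, contradicting the choice of
  \<open>J\<close>.\<close>

lemma ex_least_tube_eq:
  assumes X: "tubing G X" and I: "I \<in> X"
  shows "\<exists>v\<in>I. least_tube X v = I"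
proof (rule ccontr)
  assume contra: "\<not> ?thesis"
  have sub: "least_tube X v \<in> X \<and> v \<in> least_tube X v \<and> least_tube X v \<subset> I" if "v \<in> I" for v
    using that contra least_tube_mem[OF X I that] least_tube_subset[OF I that] by blast
  let ?P = "\<lambda>J. J \<in> X \<and> J \<subset> I"
  obtain u where "u \<in> I" using tubingD(3)[OF X I] by blast
  then have "?P (least_tube X u)" using sub by simp
  moreover have "\<forall>J. ?P J \<longrightarrow> card J < Suc (card I)"
    using tubingD(4)[OF X I] by (auto intro: card_mono le_imp_less_Suc)
  ultimately have "\<exists>J. ?P J \<and> (\<forall>K. ?P K \<longrightarrow> card K \<le> card J)"
    using ex_has_greatest_nat[of ?P "least_tube X u" card "Suc (card I)"] by simp
  then obtain J where J: "?P J" and max: "\<forall>K. ?P K \<longrightarrow> card K \<le> card J" by metis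
  obtain x where "x \<in> J" using J tubingD(3)[OF X] by blast
  moreover obtain y where "y \<in> I" "y \<notin> J" using J by blast
  ultimately obtain p q where pq: "p \<in> J" "q \<in> I" "q \<notin> J" "(p, q) \<in> E"
    using connected_on_crossing[of E I x J y] J tubingD(1)[OF X I] unfolding tube_iff by blast
  let ?K = "least_tube X q"
  have K: "?P ?K" "q \<in> ?K" using sub[OF pq(2)] by auto
  then have "J \<subset> ?K"
    using tubing_nested_edge[OF X, of J ?K p q] J pq by blast
  then have "card J < card ?K" using K(1) tubingD(4)[OF X] by (blast intro: psubset_card_mono)
  then show False using max K(1) by auto
qed

section \<open>Counting tubes, and maximality\<close>

lemma tubing_subset_image:
  assumes "tubing G X"
  shows "X \<subseteq> least_tube X ` {1..n}"
  using ex_least_tube_eq[OF assms] tubingD(2)[OF assms] by fast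

lemma card_tubing_le:
  assumes "tubing G X"
  shows "card X \<le> n"
  using surj_card_le[OF _ tubing_subset_image[OF assms]] by simp

lemma maximal_tubingD: "maximal_tubing G X \<Longrightarrow> tubing G X"
  unfolding maximal_tubing_def by (rule conjunct1)

lemma maximal_tubingI:
  assumes "tubing G X" "card X = n"
  shows "maximal_tubing G X"
  unfolding maximal_tubing_def
  using assms card_tubing_le finite_tubing card_seteq by metis

lemma maximal_tubing_insert:
  assumes X: "maximal_tubing G X" and K: "tube G K"
    and comp: "\<And>I. I \<in> X \<Longrightarrow> compatible_tubes G I K"
  shows "K \<in> X"
proof -
  have "compatible_tubes G K I" if "I \<in> X" for I
    using comp[OF that] unfolding compatible_tubes_def by (auto simp: Un_commute)
  then have "tubing G (insert K X)"
    using X K comp unfolding maximal_tubing_def tubing_def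
    by (auto simp: compatible_tubes_def)
  then show ?thesis using X unfolding maximal_tubing_def by blast
qed

text \<open>The component of \<open>v\<close> in the whole graph is compatible with every tube: if
  their union is connected, the tube lies inside the component. By maximality it belongs to
  \<open>X\<close>.\<close>

lemma maximal_tubing_covers:
  assumes X: "maximal_tubing G X" and v: "v \<in> {1..n}"
  shows "\<exists>I\<in>X. v \<in> I"
proof -
  let ?C = "component E {1..n} v"
  have "?C \<in> X"
  proof (rule maximal_tubing_insert[OF X])
    show "tube G ?C" using tube_component v by blast
    fix I
    assume "I \<in> X"
    then have I: "tube G I" using tubingD(1)[OF maximal_tubingD[OF X]] by simp
    show "compatible_tubes G I ?C"
    proof (cases "tube G (I \<union> ?C)")
      case True
      then have "I \<union> ?C \<subseteq> ?C"
        using component_absorb[of E "I \<union> ?C" "{1..n}" v v] component_self[OF v]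
        unfolding tube_iff by blast
      then show ?thesis unfolding compatible_tubes_def by blast
    qed (simp add: compatible_tubes_def)
  qed
  then show ?thesis using component_self[OF v] by blast
qed

lemma
  assumes "maximal_tubing G X" "v \<in> {1..n}"
  shows least_tube_in: "least_tube X v \<in> X" and in_least_tube: "v \<in> least_tube X v"
  using maximal_tubing_covers[OF assms] least_tube_mem[OF maximal_tubingD[OF assms(1)]] by auto

text \<open>Deleting the top of a tube leaves components that are again tubes of \<open>X\<close>.
  If \<open>K\<close> in \<open>X\<close> were incompatible with such a component \<open>?C\<close>,
  then \<open>K\<close> would be joined to \<open>?U\<close>, so properly inside \<open>?U\<close>,
  so without \<open>b\<close> because \<open>?U\<close> is the least tube of \<open>b\<close>. Then
  \<open>K \<union> ?C\<close> is connected in \<open>?U - {b}\<close>, and \<open>K\<close> falls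
  inside \<open>?C\<close>.\<close>

lemma component_in_maximal_tubing:
  assumes X: "maximal_tubing G X" and b: "b \<in> {1..n}"
    and v: "v \<in> least_tube X b" "v \<noteq> b"
  shows "component E (least_tube X b - {b}) v \<in> X"
proof (rule maximal_tubing_insert[OF X])
  let ?U = "least_tube X b" and ?C = "component E (least_tube X b - {b}) v"
  have tub: "tubing G X" using maximal_tubingD[OF X] .
  have U: "?U \<in> X" "?U \<subseteq> {1..n}" using least_tube_in[OF X b] tubingD(2)[OF tub] by auto
  have vC: "v \<in> ?C" using v by (intro component_self) auto
  have CU: "?C \<subseteq> ?U - {b}" by (rule component_subset)
  show C: "tube G ?C" using U v by (intro tube_component) auto
  fix K
  assume K: "K \<in> X"
  show "compatible_tubes G K ?C"
  proof (rule ccontr)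
    assume contra: "\<not> ?thesis"
    then have KC: "tube G (K \<union> ?C)" "\<not> K \<subseteq> ?C" "\<not> ?C \<subseteq> K"
      unfolding compatible_tubes_def by auto
    have "tube G ((K \<union> ?C) \<union> ?U)"
      using tube_Un[OF KC(1) tubingD(1)[OF tub U(1)], of v] vC v by blast
    moreover have "(K \<union> ?C) \<union> ?U = K \<union> ?U" using CU by blast
    ultimately have "tube G (K \<union> ?U)" by simp
    then have "K \<subseteq> ?U \<or> ?U \<subseteq> K"
      using tub K U(1) unfolding tubing_def compatible_tubes_def by blast
    then have "K \<subseteq> ?U" "K \<noteq> ?U" using KC(3) CU by blast+
    then have "b \<notin> K" using least_tube_subset[OF K, of b] by blast
    then have "K \<union> ?C \<subseteq> ?U - {b}" using \<open>K \<subseteq> ?U\<close> CU by blast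
    then have "K \<union> ?C \<subseteq> ?C"
      using component_absorb[of E "K \<union> ?C" _ v v] KC(1) vC unfolding tube_iff by blast
    then show False using KC(2) by blast
  qed
qed

text \<open>If \<open>u\<close> and \<open>v\<close> differed, the component of \<open>v\<close>
  after deleting \<open>u\<close> would be a tube of \<open>X\<close> containing \<open>v\<close>
  but not \<open>u\<close>, smaller than the common least tube.\<close>

lemma least_tube_inj:
  assumes X: "maximal_tubing G X" and "u \<in> {1..n}" "v \<in> {1..n}" "least_tube X u = least_tube X v"
  shows "u = v"
proof (rule ccontr)
  assume "u \<noteq> v"
  let ?C = "component E (least_tube X u - {u}) v"
  have v: "v \<in> least_tube X u" using in_least_tube[OF X assms(3)] assms(4) by simp
  then have "?C \<in> X" using component_in_maximal_tubing[OF X assms(2)] \<open>u \<noteq> v\<close> by blast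
  moreover have "v \<in> ?C" using v \<open>u \<noteq> v\<close> by (intro component_self) auto
  ultimately have "least_tube X v \<subseteq> ?C" by (rule least_tube_subset)
  then show False
    using component_subset[of E "least_tube X u - {u}" v] in_least_tube[OF X assms(2)] assms(4)
    by blast
qed

lemma bij_betw_least_tube:
  assumes X: "maximal_tubing G X"
  shows "bij_betw (least_tube X) {1..n} X"
  unfolding bij_betw_def
proof
  show "inj_on (least_tube X) {1..n}" using least_tube_inj[OF X] by (rule inj_onI)
  have "X \<subseteq> least_tube X ` {1..n}"
    using tubing_subset_image[OF maximal_tubingD[OF X]] .
  then show "least_tube X ` {1..n} = X" using least_tube_in[OF X] by blast
qed

lemma card_maximal_tubing: "maximal_tubing G X \<Longrightarrow> card X = n"
  using bij_betw_same_card[OF bij_betw_least_tube] by simp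

lemma least_tube_trans:
  assumes X: "maximal_tubing G X" and "v \<in> {1..n}" "u \<in> least_tube X v"
  shows "least_tube X u \<subseteq> least_tube X v"
  using least_tube_subset[OF least_tube_in[OF X assms(2)] assms(3)] .

lemma least_tube_antisym:
  assumes X: "maximal_tubing G X" and "u \<in> {1..n}" "v \<in> {1..n}"
    and "u \<in> least_tube X v" "v \<in> least_tube X u"
  shows "u = v"
  using assms least_tube_trans[OF X] least_tube_inj[OF X assms(2,3)] by (meson equalityI)

lemma tube_top_least_tube:
  assumes X: "maximal_tubing G X" and v: "v \<in> {1..n}"
  shows "tube_top X (least_tube X v) = v"
  unfolding tube_top_def
proof (rule the_equality)
  show "v \<in> least_tube X v \<and> (\<forall>J\<in>X. J \<subset> least_tube X v \<longrightarrow> v \<notin> J)"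
    using in_least_tube[OF X v] least_tube_subset[of _ X v] by blast
  fix i
  assume i: "i \<in> least_tube X v \<and> (\<forall>J\<in>X. J \<subset> least_tube X v \<longrightarrow> i \<notin> J)"
  then have "i \<in> {1..n}"
    using tubingD(2)[OF maximal_tubingD[OF X] least_tube_in[OF X v]] by auto
  then show "i = v"
    using i least_tube_inj[OF X _ v] least_tube_in[OF X] in_least_tube[OF X] least_tube_trans[OF X v]
    by (metis psubsetI)
qed

section \<open>From permutations to tubings\<close>

lemma Psi_eq: "Psi n G w = (\<lambda>j. component E (w ` {1..j}) (w j)) ` {1..n}"
  unfolding Psi_def scc_of_eq_component ..

lemma prefix_component_nested:
  fixes w :: "nat \<Rightarrow> nat"
  assumes "1 \<le> j" "i \<le> j" "connected_on E (component E (w ` {1..i}) (w i) \<union> component E (w ` {1..j}) (w j))"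
  shows "component E (w ` {1..i}) (w i) \<subseteq> component E (w ` {1..j}) (w j)"
proof -
  let ?C = "\<lambda>j. component E (w ` {1..j}) (w j)"
  have "w ` {1..i} \<subseteq> w ` {1..j}" using assms(2) by (intro image_mono) auto
  then have "?C i \<union> ?C j \<subseteq> w ` {1..j}"
    using component_subset[of E "w ` {1..i}" "w i"] component_subset[of E "w ` {1..j}" "w j"]
    by blast
  moreover have "w j \<in> ?C j" using assms(1) by (intro component_self) auto
  ultimately show ?thesis
    using component_absorb[OF assms(3), of _ "w j" "w j"] by blast
qed

lemma prefix_component_inj:
  assumes w: "w permutes {1..n}" and "i \<in> {1..n}" "j \<in> {1..n}"
    and eq: "component E (w ` {1..i}) (w i) = component E (w ` {1..j}) (w j)"
  shows "i = j"
proof -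
  have le: "j \<le> i" if "1 \<le> j" "component E (w ` {1..i}) (w i) = component E (w ` {1..j}) (w j)" for i j
  proof -
    have "w j \<in> component E (w ` {1..j}) (w j)" using that by (intro component_self) auto
    then have "w j \<in> w ` {1..i}" using that component_subset by (metis subsetD)
    then show ?thesis using inj_eq[OF permutes_inj[OF w]] by auto
  qed
  show ?thesis using le[of j i] le[of i j] assms by auto
qed

text \<open>The prefix components are pairwise compatible and pairwise distinct, so there are
  \<open>n\<close> of them and the count gives maximality.\<close>

lemma maximal_tubing_Psi:
  assumes w: "w permutes {1..n}"
  shows "maximal_tubing G (Psi n G w)"
proof (rule maximal_tubingI)
  let ?C = "\<lambda>j. component E (w ` {1..j}) (w j)"
  have tube: "tube G (?C j)" if "j \<in> {1..n}" for j
  proof (rule tube_component)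
    have "w ` {1..j} \<subseteq> w ` {1..n}" using that by (intro image_mono) auto
    then show "w ` {1..j} \<subseteq> {1..n}" using permutes_image[OF w] by simp
    show "w j \<in> w ` {1..j}" using that by auto
  qed
  have "compatible_tubes G (?C i) (?C j)" if "i \<in> {1..n}" "j \<in> {1..n}" for i j
  proof (cases "i \<le> j")
    case True
    then show ?thesis
      using that prefix_component_nested[of j i w] unfolding compatible_tubes_def tube_iff by auto
  next
    case False
    then show ?thesis
      using that prefix_component_nested[of i j w] unfolding compatible_tubes_def tube_iff
      by (auto simp: Un_commute)
  qed
  then show "tubing G (Psi n G w)" using tube unfolding Psi_eq tubing_def by blast
  have "inj_on ?C {1..n}" using prefix_component_inj[OF w] by (rule inj_onI)
  then show "card (Psi n G w) = n" unfolding Psi_eq by (simp add: card_image)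
qed

text \<open>Thus \<open>w j\<close> is the top of the \<open>j\<close>-th tube. Any tube containing
  \<open>w j\<close> comes from a prefix of length at least \<open>j\<close>, and two components
  sharing \<open>w j\<close> are nested.\<close>

lemma least_tube_Psi:
  assumes w: "w permutes {1..n}" and j: "j \<in> {1..n}"
  shows "least_tube (Psi n G w) (w j) = component E (w ` {1..j}) (w j)"
proof (rule least_tube_eqI)
  let ?C = "\<lambda>j. component E (w ` {1..j}) (w j)"
  show "?C j \<in> Psi n G w" using j unfolding Psi_eq by blast
  show wj: "w j \<in> ?C j" using j by (intro component_self) auto
  fix J
  assume J: "J \<in> Psi n G w" "w j \<in> J"
  then obtain i where i: "i \<in> {1..n}" "J = ?C i" unfolding Psi_eq by blast
  then have "w j \<in> w ` {1..i}" using J component_subset by (metis subsetD)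
  then have "j \<le> i" using inj_eq[OF permutes_inj[OF w]] by auto
  moreover have "connected_on E (?C j \<union> ?C i)"
    using wj J(2) i j by (intro connected_on_Un[of _ _ _ "w j"] component_connected sym_E) auto
  ultimately show "?C j \<subseteq> J" using prefix_component_nested[of i j w] i by auto
qed

text \<open>The hypothesis \<open>ext\<close> says that \<open>w\<close> is a linear extension of
  the forest order of \<open>X\<close>. The least tube of \<open>w j\<close> then lies in the prefix
  ending at \<open>w j\<close>, so in its component; an edge by which the component left that tube
  would lead to a vertex placed after \<open>w j\<close>.\<close>

lemma Psi_eqI:
  assumes X: "maximal_tubing G X" and w: "w permutes {1..n}"
    and ext: "\<And>i k. i \<in> {1..n} \<Longrightarrow> k \<in> {1..n} \<Longrightarrow> i \<in> least_tube X k \<Longrightarrow> inv w i \<le> inv w k"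
  shows "Psi n G w = X"
proof -
  have tub: "tubing G X" using maximal_tubingD[OF X] .
  have "component E (w ` {1..j}) (w j) = least_tube X (w j)" if j: "j \<in> {1..n}" for j
  proof
    let ?C = "component E (w ` {1..j}) (w j)" and ?T = "least_tube X (w j)"
    have mem: "w i \<in> {1..n} \<longleftrightarrow> i \<in> {1..n}" for i using permutes_in_image[OF w] .
    have T: "?T \<in> X" "w j \<in> ?T" using X j mem least_tube_in in_least_tube by blast+
    have wj: "w j \<in> ?C" using j by (intro component_self) auto
    have "?T \<subseteq> w ` {1..j}"
    proof
      fix x
      assume x: "x \<in> ?T"
      then have xn: "x \<in> {1..n}" using tubingD(2)[OF tub T(1)] by blast
      then have "inv w x \<le> j"
        using ext[OF xn _ x] j mem permutes_inverses(2)[OF w] by metis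
      moreover have "inv w x \<in> {1..n}" using xn mem permutes_inverses(1)[OF w] by metis
      ultimately have "inv w x \<in> {1..j}" by auto
      then show "x \<in> w ` {1..j}" using permutes_inverses(1)[OF w] by (metis imageI)
    qed
    then show TC: "?T \<subseteq> ?C"
      using component_absorb[of E ?T _ "w j" "w j"] T wj tubingD(1)[OF tub T(1)]
      unfolding tube_iff by blast
    show "?C \<subseteq> ?T"
    proof (rule ccontr)
      assume "\<not> ?thesis"
      then obtain x where x: "x \<in> ?C" "x \<notin> ?T" by blast
      have "connected_on E ?C" using j by (intro component_connected sym_E) auto
      then obtain p q where pq: "p \<in> ?T" "q \<in> ?C" "q \<notin> ?T" "(p, q) \<in> E"
        using connected_on_crossing[of E ?C "w j" ?T x, OF _ wj T(2) x] by auto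
      then obtain i where i: "q = w i" "i \<in> {1..j}"
        using component_subset[of E "w ` {1..j}" "w j"] by blast
      have qn: "q \<in> {1..n}" using i j mem by auto
      then have S: "least_tube X q \<in> X" "q \<in> least_tube X q"
        using X least_tube_in in_least_tube by blast+
      \<comment> \<open>Since \<open>q\<close> is adjacent to \<open>?T\<close> but outside it,
        nestedness forces its least tube to swallow \<open>?T\<close>.\<close>
      have "?T \<subseteq> least_tube X q"
        using tubing_nested_edge[OF tub T(1) S(1) pq(1) S(2) pq(4)] S(2) pq(3) by blast
      then have "inv w (w j) \<le> inv w q" using ext[of "w j" q] T(2) qn mem j by blast
      then have "j \<le> i" using i permutes_inverses(2)[OF w] by simp
      then have "q = w j" using i by auto
      then show False using pq(3) T(2) by simp
    qed
  qed
  then have "Psi n G w = (\<lambda>j. least_tube X (w j)) ` {1..n}"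
    unfolding Psi_eq by (intro image_cong) auto
  also have "\<dots> = least_tube X ` w ` {1..n}" by (rule image_image[symmetric])
  also have "\<dots> = X"
    using bij_betw_least_tube[OF X] permutes_image[OF w] unfolding bij_betw_def by simp
  finally show ?thesis .
qed

section \<open>Order preservation\<close>

text \<open>Only the prefix of length \<open>j\<close> changes as a set. If \<open>a\<close> and
  \<open>b\<close> are connected within the prefix of length \<open>j + 1\<close>, exactly one tube
  is replaced and its top rises from \<open>a\<close> to \<open>b\<close>; otherwise the tubing is
  unchanged.\<close>

lemma Psi_adjacent_transposition:
  assumes v: "v permutes {1..n}" and j: "1 \<le> j" "j < n" "v j < v (Suc j)"
  shows "(Psi n G v, Psi n G (v \<circ> transpose j (Suc j))) \<in> (flip G)\<^sup>="
proof -
  let ?t = "transpose j (Suc j)"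
  let ?w = "v \<circ> ?t"
  define C where "C m = component E (v ` {1..m}) (v m)" for m
  define D where "D m = component E (?w ` {1..m}) (?w m)" for m
  define a b where "a = v j" and "b = v (Suc j)"
  define S T where "S = v ` {1..<j}" and "T = insert a (insert b S)"
  have t: "?t permutes {1..n}" using j by (intro permutes_swap_id) auto
  have w: "?w permutes {1..n}" using permutes_compose[OF t v] .
  have wj: "?w j = b" "?w (Suc j) = a" by (simp_all add: a_def b_def)
  have vinj: "v x = v y \<longleftrightarrow> x = y" for x y using inj_eq[OF permutes_inj[OF v]] .
  have notin: "a \<notin> S" "b \<notin> S" "a \<noteq> b"
    unfolding a_def b_def S_def by (auto simp: vinj)
  have pre: "?w ` {1..m} = v ` {1..m}" if "m \<noteq> j" for m
  proof -
    have "?t ` {1..m} = {1..m}"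
    proof (cases "m < j")
      case True
      then have "?t x = x" if "x \<in> {1..m}" for x using that by (auto simp: transpose_def)
      then show ?thesis by (auto simp: image_iff)
    next
      case False
      then have "?t permutes {1..m}" using j \<open>m \<noteq> j\<close> by (intro permutes_swap_id) auto
      then show ?thesis by (rule permutes_image)
    qed
    then show ?thesis by (metis image_comp)
  qed
  have ivl: "{1..j} = insert j {1..<j}" "{1..Suc j} = insert j (insert (Suc j) {1..<j})"
    using j by auto
  have vT: "v ` {1..j} = insert a S" "v ` {1..Suc j} = T"
    unfolding ivl a_def b_def S_def T_def by simp_all
  have "?w ` {1..<j} = S" unfolding S_def by (intro image_cong) (auto simp: transpose_def)
  then have wT: "?w ` {1..j} = insert b S" unfolding ivl using wj by simp
  have wT': "?w ` {1..Suc j} = T" using pre[of "Suc j"] vT by simp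
  have CD: "C j = component E (insert a S) a" "C (Suc j) = component E T b"
    "D j = component E (insert b S) b" "D (Suc j) = component E T a"
    unfolding C_def D_def vT wT wT' wj by (simp_all add: a_def b_def)
  have rest: "D m = C m" if "m \<noteq> j" "m \<noteq> Suc j" for m
    using that pre[of m] unfolding C_def D_def by simp
  have Psi: "Psi n G v = C ` {1..n}" "Psi n G ?w = D ` {1..n}"
    unfolding Psi_eq C_def D_def by simp_all
  have Tdiff: "T - {b} = insert a S" "T - {a} = insert b S"
    using notin unfolding T_def by auto
  show ?thesis
  proof (cases "b \<in> component E T a")
    case True
    \<comment> \<open>\<open>a\<close> and \<open>b\<close> have the same component in
      \<open>T\<close>, so the tubes at position \<open>j + 1\<close> agree and only the one at
      \<open>j\<close> can differ.\<close>
    then have "D m = C m" if "m \<noteq> j" for m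
      using that rest[of m] CD component_cong[OF sym_E True] by auto
    then have "D ` ({1..n} - {j}) = C ` ({1..n} - {j})" by (intro image_cong) auto
    also have "\<dots> = C ` {1..n} - {C j}"
    proof -
      have "inj_on C {1..n}"
        unfolding C_def using prefix_component_inj[OF v] by (rule inj_onI)
      then show ?thesis using inj_on_image_set_diff[of C "{1..n}" "{1..n}" "{j}"] j by auto
    qed
    finally have img: "D ` ({1..n} - {j}) = C ` {1..n} - {C j}" .
    have jn: "j \<in> {1..n}" using j by auto
    then have "D ` {1..n} = insert (D j) (D ` ({1..n} - {j}))" by blast
    then have "Psi n G ?w = (Psi n G v - {C j}) \<union> {D j}" unfolding Psi img by simp
    moreover have "C j \<in> Psi n G v" unfolding Psi using jn by blast
    moreover have "C j \<noteq> D j"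
      using component_self[of a "insert a S" E] component_subset[of E "insert b S" b] notin
      unfolding CD by blast
    moreover have "tube_top (Psi n G v) (C j) = a"
      using tube_top_least_tube[OF maximal_tubing_Psi[OF v], of "v j"] least_tube_Psi[OF v jn]
        permutes_in_image[OF v, of j] jn unfolding C_def a_def by simp
    moreover have "tube_top (Psi n G ?w) (D j) = b"
      using tube_top_least_tube[OF maximal_tubing_Psi[OF w], of "?w j"] least_tube_Psi[OF w jn]
        permutes_in_image[OF w, of j] jn wj(1) unfolding D_def by simp
    moreover have "a < b" using j(3) unfolding a_def b_def .
    ultimately have "(Psi n G v, Psi n G ?w) \<in> flip G"
      unfolding flip_def using maximal_tubing_Psi[OF v] maximal_tubing_Psi[OF w]
      by (intro CollectI case_prodI conjI exI[of _ "C j"] exI[of _ "D j"]) simp_all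
    then show ?thesis by blast
  next
    case False
    have aT: "a \<in> T" and bT: "b \<in> T" unfolding T_def by auto
    \<comment> \<open>The components of \<open>a\<close> and \<open>b\<close> in \<open>T\<close>
      are distinct, so deleting either vertex leaves the other's component intact: the tubes at
      \<open>j\<close> and \<open>j + 1\<close> trade places.\<close>
    have "a \<notin> component E T b"
      using False component_cong[OF sym_E] component_self[OF bT] by metis
    then have "D j = C (Suc j)"
      using component_Diff[of a E T b] bT sym_E unfolding CD Tdiff by simp
    moreover have "D (Suc j) = C j"
      using component_Diff[of b E T a] False aT sym_E unfolding CD Tdiff by simp
    ultimately have "D m = C (?t m)" for m
      using rest[of m] by (auto simp: transpose_def)
    then have "D ` {1..n} = C ` ?t ` {1..n}" by (auto simp: image_iff)
    then show ?thesis unfolding Psi permutes_image[OF t] by simp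
  qed
qed

text \<open>Climb from \<open>v\<close> to \<open>w\<close> by adjacent transpositions, each adding
  one inversion of \<open>w\<close>; the induction is on the number of inversions still
  missing.\<close>

lemma Psi_mono:
  assumes "v permutes {1..n}" and w: "w permutes {1..n}" and "inversions n v \<subseteq> inversions n w"
  shows "(Psi n G v, Psi n G w) \<in> (flip G)\<^sup>*"
  using assms(1,3)
proof (induct "card (inversions n w - inversions n v)" arbitrary: v rule: less_induct)
  case less
  note v = less.prems(1)
  show ?case
  proof (cases "v = w")
    case False
    then obtain j where j: "1 \<le> j" "j < n" "v j < v (Suc j)"
      and asc: "(v j, v (Suc j)) \<in> inversions n w"
      using ex_ascent[OF v w less.prems(2)] by blast
    let ?t = "transpose j (Suc j)"
    have vt: "v \<circ> ?t permutes {1..n}"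
      using j by (intro permutes_compose[OF _ v] permutes_swap_id) auto
    have inv: "inversions n (v \<circ> ?t) = insert (v j, v (Suc j)) (inversions n v)"
      using inversions_adjacent_transposition[OF v j] .
    have "(v j, v (Suc j)) \<notin> inversions n v"
      using permutes_inverses(2)[OF v] by (simp add: inversions_iff[OF v])
    then have "inversions n w - inversions n (v \<circ> ?t) \<subset> inversions n w - inversions n v"
      using asc unfolding inv by blast
    moreover have "finite (inversions n w - inversions n v)"
      using finite_subset[OF inversions_subset[OF w] finite_increasing_pairs] by blast
    ultimately have "card (inversions n w - inversions n (v \<circ> ?t)) < card (inversions n w - inversions n v)"
      by (intro psubset_card_mono)
    then have "(Psi n G (v \<circ> ?t), Psi n G w) \<in> (flip G)\<^sup>*"
      using less.hyps[OF _ vt] asc less.prems(2) unfolding inv by simp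
    then show ?thesis
      using Psi_adjacent_transposition[OF v j] by (auto intro: converse_rtrancl_into_rtrancl)
  qed simp
qed

section \<open>The greatest linear extension of a maximal tubing\<close>

definition noninversions :: "nat set set \<Rightarrow> nat rel" where
  "noninversions X = {(i, k). k \<in> {1..n} \<and> i < k \<and> i \<in> least_tube X k}"

lemma noninversions_subset:
  assumes "maximal_tubing G X"
  shows "noninversions X \<subseteq> increasing_pairs n"
proof -
  have "1 \<le> i" if "i \<in> least_tube X k" "k \<in> {1..n}" for i k
    using tubingD(2)[OF maximal_tubingD[OF assms] least_tube_in[OF assms that(2)]] that(1) by auto
  then show ?thesis unfolding noninversions_def increasing_pairs_def by auto
qed

text \<open>Such a \<open>w\<close> is a linear extension: a related pair \<open>i < k\<close> keeps
  its order, and if \<open>k < i\<close> then antisymmetry puts \<open>(k, i)\<close> outside the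
  noninversions, so \<open>i\<close> again comes first.\<close>

lemma Psi_eq_if_noninversions:
  assumes X: "maximal_tubing G X" and w: "w permutes {1..n}"
    and inv: "inversions n w = increasing_pairs n - noninversions X"
  shows "Psi n G w = X"
proof (rule Psi_eqI[OF X w])
  fix i k
  assume i: "i \<in> {1..n}" and k: "k \<in> {1..n}" and ik: "i \<in> least_tube X k"
  consider "i = k" | "i < k" | "k < i" by linarith
  then show "inv w i \<le> inv w k"
  proof cases
    case 2
    then have "(i, k) \<notin> inversions n w" using k ik unfolding inv noninversions_def by simp
    then show ?thesis using 2 i k inversions_iff[OF w] by auto
  next
    case 3
    then have "(k, i) \<notin> noninversions X"
      using least_tube_antisym[OF X i k ik] unfolding noninversions_def by auto
    then have "(k, i) \<in> inversions n w"
      using 3 i k unfolding inv increasing_pairs_def by simp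
    then show ?thesis using inversions_iff[OF w] by simp
  qed simp
qed

text \<open>The least tube of \<open>k\<close> is a component of the prefix ending at
  \<open>k\<close>, so all its vertices occur no later than \<open>k\<close>.\<close>

lemma inversions_Psi:
  assumes w: "w permutes {1..n}"
  shows "inversions n w \<subseteq> increasing_pairs n - noninversions (Psi n G w)"
proof -
  have "(i, k) \<notin> inversions n w" if "(i, k) \<in> noninversions (Psi n G w)" for i k
  proof -
    let ?m = "inv w k"
    have k: "k \<in> {1..n}" "i \<in> least_tube (Psi n G w) k"
      using that unfolding noninversions_def by auto
    then have "?m \<in> {1..n}" using permutes_in_image[OF permutes_inv[OF w]] by blast
    then have "least_tube (Psi n G w) k = component E (w ` {1..?m}) k"
      using least_tube_Psi[OF w, of ?m] permutes_inverses(1)[OF w] by simp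
    then have "i \<in> w ` {1..?m}" using k(2) component_subset[of E "w ` {1..?m}" k] by auto
    then have "inv w i \<le> ?m" using permutes_inverses(2)[OF w] by auto
    then show ?thesis using inversions_iff[OF w] by auto
  qed
  then show ?thesis using inversions_subset[OF w] by auto
qed

end

section \<open>Consequences of left-filledness\<close>

locale left_filled_graph_on = graph_on +
  assumes left_filled: "left_filled G"
begin

text \<open>Some edge of \<open>U\<close> jumps over \<open>j\<close>; left-filledness replaces its
  right end by \<open>j\<close>. Left-filledness enters the proof only through this step.\<close>

lemma left_neighbour:
  assumes U: "connected_on E U" and "i \<in> U" "k \<in> U" and ijk: "i < j" "j < k" and "j \<notin> U"
  shows "\<exists>p\<in>U. p < j \<and> (p, j) \<in> E"
proof -
  obtain p q where pq: "p \<in> {..<j} \<inter> U" "q \<in> U - {..<j}" "(p, q) \<in> E"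
    using connected_on_crossing[OF U \<open>i \<in> U\<close>, of "{..<j}" k] assms by auto
  then have "p < j" "j < q" using \<open>j \<notin> U\<close> by (auto simp: not_less le_less)
  then have "(p, j) \<in> E" using pq(3) left_filled unfolding left_filled_def by blast
  then show ?thesis using pq(1) by blast
qed

text \<open>The first clause is transitivity of the forest order. For the second, if
  \<open>j\<close> is outside the least tube of \<open>k\<close>, then \<open>left_neighbour\<close>
  makes \<open>j\<close> adjacent to that tube, so the least tube of \<open>j\<close> contains it,
  and with it \<open>i\<close>.\<close>

lemma biclosed_noninversions:
  assumes X: "maximal_tubing G X"
  shows "biclosed (noninversions X)"
proof -
  have "(i, k) \<in> noninversions X"
    if "(i, j) \<in> noninversions X" "(j, k) \<in> noninversions X" for i j k
    using that least_tube_trans[OF X, of k j] unfolding noninversions_def by auto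
  moreover have "(i, j) \<in> noninversions X \<or> (j, k) \<in> noninversions X"
    if ijk: "i < j" "j < k" and ik: "(i, k) \<in> noninversions X" for i j k
  proof (cases "j \<in> least_tube X k")
    case True
    then show ?thesis using ijk ik unfolding noninversions_def by auto
  next
    case False
    have k: "k \<in> {1..n}" and i: "i \<in> least_tube X k" using ik unfolding noninversions_def by auto
    have j: "j \<in> {1..n}" using ijk k by auto
    note tub = maximal_tubingD[OF X]
    note T = least_tube_in[OF X k] least_tube_in[OF X j]
    have "connected_on E (least_tube X k)" using tubingD(1)[OF tub T(1)] unfolding tube_iff by blast
    then obtain p where p: "p \<in> least_tube X k" "(p, j) \<in> E"
      using left_neighbour[OF _ i in_least_tube[OF X k] ijk False] by blast
    have "least_tube X k \<subseteq> least_tube X j"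
      using tubing_nested_edge[OF tub T p(1) in_least_tube[OF X j] p(2)] in_least_tube[OF X j] False
      by blast
    then show ?thesis using i ijk j unfolding noninversions_def by auto
  qed
  ultimately show ?thesis unfolding biclosed_def by blast
qed

lemma ex_greatest_extension:
  assumes X: "maximal_tubing G X"
  obtains w where "w permutes {1..n}" "inversions n w = increasing_pairs n - noninversions X"
    "Psi n G w = X"
  using ex_permutation_inversions[OF biclosed_Diff[OF biclosed_noninversions[OF X]]]
    Psi_eq_if_noninversions[OF X] by blast

text \<open>With \<open>a < b\<close> the tops of \<open>I\<close> and \<open>J\<close>, a flip
  changes only the least tubes of \<open>a\<close> and \<open>b\<close>: that of \<open>b\<close>
  shrinks from \<open>U\<close> to \<open>J\<close>, that of \<open>a\<close> grows from
  \<open>I\<close> to \<open>U\<close>. It remains to see that every vertex of \<open>U\<close>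
  below \<open>a\<close> was already in \<open>I\<close>.\<close>

lemma noninversions_flip:
  assumes "(X, Y) \<in> flip G"
  shows "noninversions Y \<subseteq> noninversions X"
proof -
  obtain I J where X: "maximal_tubing G X" and Y: "maximal_tubing G Y"
    and IJ: "I \<in> X" "I \<noteq> J" "Y = (X - {I}) \<union> {J}" "tube_top X I < tube_top Y J"
    using assms unfolding flip_def by blast
  have "J \<in> Y" using IJ by blast
  obtain a where a: "a \<in> {1..n}" "I = least_tube X a"
    using bij_betw_least_tube[OF X] IJ(1) unfolding bij_betw_def by blast
  obtain b where b: "b \<in> {1..n}" "J = least_tube Y b"
    using bij_betw_least_tube[OF Y] \<open>J \<in> Y\<close> unfolding bij_betw_def by blast
  have ab: "a < b"
    using IJ(4) tube_top_least_tube[OF X a(1)] tube_top_least_tube[OF Y b(1)] a(2) b(2) by simp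
  \<comment> \<open>Otherwise \<open>Y\<close> would have fewer than \<open>n\<close> tubes.\<close>
  have "J \<notin> X"
  proof
    assume "J \<in> X"
    then have "Y = X - {I}" using IJ(2,3) by blast
    then have "card Y < card X"
      using IJ(1) finite_tubing[OF maximal_tubingD[OF X]] by (metis card_Diff1_less)
    then show False using card_maximal_tubing X Y by simp
  qed
  \<comment> \<open>Only the tubes with tops \<open>a\<close> and \<open>b\<close> are exchanged, so
    the least tube of \<open>v\<close> survives in both directions.\<close>
  have same: "least_tube Y v = least_tube X v" if v: "v \<in> {1..n}" "v \<noteq> a" "v \<noteq> b" for v
  proof
    have "least_tube X v \<noteq> I" using least_tube_inj[OF X v(1) a(1)] v(2) a(2) by blast
    then have "least_tube X v \<in> Y" using least_tube_in[OF X v(1)] IJ(3) by blast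
    then show "least_tube Y v \<subseteq> least_tube X v"
      using in_least_tube[OF X v(1)] by (rule least_tube_subset)
    have "least_tube Y v \<noteq> J" using least_tube_inj[OF Y v(1) b(1)] v(3) b(2) by blast
    then have "least_tube Y v \<in> X" using least_tube_in[OF Y v(1)] IJ(3) by blast
    then show "least_tube X v \<subseteq> least_tube Y v"
      using in_least_tube[OF Y v(1)] by (rule least_tube_subset)
  qed
  define U where "U = least_tube X b"
  have UX: "U \<in> X" unfolding U_def using least_tube_in[OF X b(1)] .
  have "U \<noteq> I" using least_tube_inj[OF X b(1) a(1)] ab a(2) unfolding U_def by blast
  then have UY: "U \<in> Y" using UX IJ(3) by blast
  then obtain c where c: "c \<in> {1..n}" "U = least_tube Y c"
    using bij_betw_least_tube[OF Y] unfolding bij_betw_def by blast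
  \<comment> \<open>The top \<open>c\<close> of \<open>U\<close> in \<open>Y\<close> must be
    \<open>a\<close>: \<open>J\<close> is not in \<open>X\<close>, and any third vertex keeps its
    least tube, which differs from \<open>U\<close>.\<close>
  have "c \<noteq> b" using \<open>J \<notin> X\<close> UX b(2) c(2) by blast
  moreover have "c = b" if "c \<noteq> a"
  proof (rule ccontr)
    assume "c \<noteq> b"
    then have "least_tube X c = least_tube X b" using same[OF c(1) that] c(2) U_def by simp
    then show False using least_tube_inj[OF X c(1) b(1)] \<open>c \<noteq> b\<close> by blast
  qed
  ultimately have Ya: "least_tube Y a = U" using c by blast
  show ?thesis
  proof (rule subrelI)
    fix i k
    assume "(i, k) \<in> noninversions Y"
    then have k: "k \<in> {1..n}" and ik: "i < k" "i \<in> least_tube Y k"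
      unfolding noninversions_def by auto
    have "i \<in> least_tube X k"
    proof -
      consider "k = a" | "k = b" | "k \<noteq> a" "k \<noteq> b" by blast
      then show ?thesis
      proof cases
        case 1
        let ?K = "component E (U - {b}) i"
        have iU: "i \<in> U" and ia: "i < a" using ik 1 Ya by auto
        have bU: "b \<in> U" using in_least_tube[OF X b(1)] U_def by simp
        have aU: "a \<in> U" using in_least_tube[OF Y a(1)] Ya by simp
        have ib: "i \<in> U - {b}" using iU ia ab by auto
        have iK: "i \<in> ?K" using ib by (rule component_self)
        have K_sub: "?K \<subseteq> U - {b}" by (rule component_subset)
        have K_conn: "connected_on E ?K" using component_connected[OF sym_E ib] .
        have "connected_on E U"
          using tubingD(1)[OF maximal_tubingD[OF X] UX] unfolding tube_iff by blast
        then obtain p q where pq: "p \<in> ?K" "q \<in> U" "q \<notin> ?K" "(p, q) \<in> E"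
          using connected_on_crossing[OF _ iU iK bU] K_sub by blast
        \<comment> \<open>Inside \<open>U\<close> a component of \<open>U - {b}\<close> can only be
          left through \<open>b\<close>.\<close>
        then have "q = b" using component_absorb_edge[of p E "U - {b}" i q] by blast
        then have Kb: "connected_on E (?K \<union> {b})"
          using connected_on_Un_edge[OF sym_E K_conn connected_on_edge[OF sym_E pq(4)] pq(1) _ pq(4)]
            pq(1) by (simp add: insert_absorb)
        \<comment> \<open>Now \<open>?K \<union> {b}\<close> is connected and contains
          \<open>i < a < b\<close>. If it missed \<open>a\<close>, then \<open>a\<close> would have
          a smaller neighbour in it, which lies in \<open>?K\<close> as \<open>a < b\<close>, and so
          \<open>a\<close> would belong to the component after all.\<close>
        have aK: "a \<in> ?K"
        proof (rule ccontr)
          assume "a \<notin> ?K"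
          then obtain r where r: "r \<in> ?K \<union> {b}" "r < a" "(r, a) \<in> E"
            using left_neighbour[OF Kb _ _ ia ab] iK ab by blast
          then have "r \<in> ?K" using ab by auto
          then show False
            using component_absorb_edge[of r E "U - {b}" i a] r(3) aU ab \<open>a \<notin> ?K\<close> by blast
        qed
        have "?K \<in> X"
          using component_in_maximal_tubing[OF X b(1)] ib unfolding U_def by blast
        \<comment> \<open>In \<open>Y\<close> the least tube of \<open>a\<close> is
          \<open>U\<close>, which contains \<open>b\<close>. So \<open>?K\<close> is the tube that
          the flip removes, namely \<open>I\<close>.\<close>
        moreover have "?K \<notin> Y"
        proof
          assume "?K \<in> Y"
          then have "U \<subseteq> ?K" using least_tube_subset[OF _ aK] Ya by blast
          then show False using K_sub bU by blast
        qed
        ultimately have "?K = I" using IJ(3) by blast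
        then show ?thesis using iK a(2) 1 by simp
      next
        case 2
        have "b \<in> U" using in_least_tube[OF X b(1)] U_def by simp
        then have "least_tube Y b \<subseteq> U" using least_tube_subset[OF UY] by blast
        then show ?thesis using ik 2 U_def by blast
      next
        case 3
        then show ?thesis using same[OF k] ik by simp
      qed
    qed
    then show "(i, k) \<in> noninversions X" using k ik unfolding noninversions_def by simp
  qed
qed

lemma noninversions_antimono: "(X, Y) \<in> (flip G)\<^sup>* \<Longrightarrow> noninversions Y \<subseteq> noninversions X"
  by (induct rule: rtrancl_induct) (use noninversions_flip in blast)+

text \<open>Both tubings are the image under \<open>Psi\<close> of the same greatest extension. This
  gives antisymmetry of the tubing order.\<close>

lemma noninversions_inj:
  assumes "maximal_tubing G X" "maximal_tubing G Y" "noninversions X = noninversions Y"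
  shows "X = Y"
proof -
  obtain w where "w permutes {1..n}" "inversions n w = increasing_pairs n - noninversions X"
    using ex_greatest_extension[OF assms(1)] .
  then show ?thesis using Psi_eq_if_noninversions assms by metis
qed

text \<open>
  The map sending a maximal tubing to its greatest linear extension is right adjoint to \<open>\<Psi>\<close>.
\<close>

lemma Psi_le_iff:
  assumes w: "w permutes {1..n}" and Y: "maximal_tubing G Y"
  shows "(Psi n G w, Y) \<in> (flip G)\<^sup>* \<longleftrightarrow> inversions n w \<subseteq> increasing_pairs n - noninversions Y"
proof
  assume "(Psi n G w, Y) \<in> (flip G)\<^sup>*"
  then show "inversions n w \<subseteq> increasing_pairs n - noninversions Y"
    using noninversions_antimono inversions_Psi[OF w] by blast
next
  assume le: "inversions n w \<subseteq> increasing_pairs n - noninversions Y"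
  obtain u where "u permutes {1..n}" "inversions n u = increasing_pairs n - noninversions Y"
    "Psi n G u = Y"
    using ex_greatest_extension[OF Y] .
  then show "(Psi n G w, Y) \<in> (flip G)\<^sup>*" using Psi_mono[OF w] le by metis
qed

section \<open>Joins and meets\<close>

lemma partial_order_tubing_order: "partial_order (tubing_order G)"
proof
  fix X Y
  assume "X \<sqsubseteq>\<^bsub>tubing_order G\<^esub> Y" "Y \<sqsubseteq>\<^bsub>tubing_order G\<^esub> X"
    and "X \<in> carrier (tubing_order G)" "Y \<in> carrier (tubing_order G)"
  then show "X .=\<^bsub>tubing_order G\<^esub> Y"
    unfolding tubing_order_def
    by (simp add: noninversions_inj noninversions_antimono subset_antisym)
qed (auto simp: tubing_order_def)

text \<open>The inversion set of any upper bound is transitive and contains both given sets, hence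
  also the transitive closure of their union.\<close>

lemma ex_weak_order_join:
  assumes v: "v \<in> carrier (weak_order n)" and w: "w \<in> carrier (weak_order n)"
  shows "\<exists>s. least (weak_order n) s (Upper (weak_order n) {v, w})"
proof -
  let ?A = "inversions n v" and ?B = "inversions n w"
  have perm: "v permutes {1..n}" "w permutes {1..n}"
    using v w unfolding weak_order_def by auto
  have "biclosed ((?A \<union> ?B)\<^sup>+)"
    using perm by (intro biclosed_trancl_Un biclosed_inversions)
  moreover have "(?A \<union> ?B)\<^sup>+ \<subseteq> increasing_pairs n"
    using perm by (intro trancl_increasing_pairs Un_least inversions_subset)
  ultimately obtain s where s: "s permutes {1..n}" "inversions n s = (?A \<union> ?B)\<^sup>+"
    using ex_permutation_inversions by blast
  have "?A \<subseteq> inversions n s" "?B \<subseteq> inversions n s" unfolding s(2) by auto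
  moreover have "inversions n s \<subseteq> inversions n u"
    if u: "u permutes {1..n}" "?A \<subseteq> inversions n u" "?B \<subseteq> inversions n u" for u
    unfolding s(2) using u
    by (intro trancl_subset_trans Un_least trans_biclosed[OF biclosed_inversions inversions_subset])
  ultimately have "least (weak_order n) s (Upper (weak_order n) {v, w})"
    unfolding least_def using s(1) Upper_pair[OF v w] by (auto simp: weak_order_def)
  then show ?thesis by blast
qed

text \<open>Left adjoints preserve joins: if \<open>Y\<close> bounds both images, its greatest
  extension bounds \<open>v\<close> and \<open>w\<close>, hence \<open>s\<close>, and adjunction
  brings this back to \<open>Y\<close>.\<close>

lemma least_Psi:
  assumes v: "v \<in> carrier (weak_order n)" and w: "w \<in> carrier (weak_order n)"
    and s: "least (weak_order n) s (Upper (weak_order n) {v, w})"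
  shows "least (tubing_order G) (Psi n G s) (Upper (tubing_order G) {Psi n G v, Psi n G w})"
proof -
  have perm: "v permutes {1..n}" "w permutes {1..n}"
    using v w unfolding weak_order_def by auto
  have carrier: "Psi n G v \<in> carrier (tubing_order G)" "Psi n G w \<in> carrier (tubing_order G)"
    using maximal_tubing_Psi perm unfolding tubing_order_def by auto
  have s_perm: "s permutes {1..n}" and le: "inversions n v \<subseteq> inversions n s" "inversions n w \<subseteq> inversions n s"
    using s Upper_pair[OF v w] unfolding least_def by (auto simp: weak_order_def)
  have "(Psi n G s, Y) \<in> (flip G)\<^sup>*"
    if Y: "maximal_tubing G Y" "(Psi n G v, Y) \<in> (flip G)\<^sup>*" "(Psi n G w, Y) \<in> (flip G)\<^sup>*" for Y
  proof -
    obtain u where u: "u permutes {1..n}" "inversions n u = increasing_pairs n - noninversions Y"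
      using ex_greatest_extension[OF Y(1)] .
    then have "u \<in> Upper (weak_order n) {v, w}"
      using Y Psi_le_iff perm Upper_pair[OF v w] by (simp add: weak_order_def)
    then have "inversions n s \<subseteq> inversions n u"
      using s unfolding least_def by (simp add: weak_order_def)
    then show ?thesis using Psi_le_iff[OF s_perm Y(1)] u(2) by simp
  qed
  then show ?thesis
    unfolding least_def using Upper_pair[OF carrier] maximal_tubing_Psi[OF s_perm]
      Psi_mono[OF perm(1) s_perm le(1)] Psi_mono[OF perm(2) s_perm le(2)]
    by (auto simp: tubing_order_def)
qed

text \<open>The meet is \<open>Psi n G m\<close>, where \<open>m\<close> is the weak-order meet of
  the greatest extensions of \<open>X\<close> and \<open>Y\<close>. A lower bound \<open>Z\<close>
  has a transitive noninversion set containing both, so its greatest extension lies below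
  \<open>m\<close>.\<close>

lemma ex_tubing_order_meet:
  assumes X: "X \<in> carrier (tubing_order G)" and Y: "Y \<in> carrier (tubing_order G)"
  shows "\<exists>Z. greatest (tubing_order G) Z (Lower (tubing_order G) {X, Y})"
proof -
  let ?A = "noninversions X" and ?B = "noninversions Y"
  have max: "maximal_tubing G X" "maximal_tubing G Y"
    using X Y unfolding tubing_order_def by auto
  have "biclosed ((?A \<union> ?B)\<^sup>+)"
    using max by (intro biclosed_trancl_Un biclosed_noninversions)
  then obtain m where m: "m permutes {1..n}" "inversions n m = increasing_pairs n - (?A \<union> ?B)\<^sup>+"
    using ex_permutation_inversions[OF biclosed_Diff] by blast
  have "(Psi n G m, X) \<in> (flip G)\<^sup>*" "(Psi n G m, Y) \<in> (flip G)\<^sup>*"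
    unfolding Psi_le_iff[OF m(1) max(1)] Psi_le_iff[OF m(1) max(2)] m(2) by auto
  moreover have "(Z, Psi n G m) \<in> (flip G)\<^sup>*"
    if Z: "maximal_tubing G Z" "(Z, X) \<in> (flip G)\<^sup>*" "(Z, Y) \<in> (flip G)\<^sup>*" for Z
  proof -
    obtain u where u: "u permutes {1..n}" "inversions n u = increasing_pairs n - noninversions Z"
      "Psi n G u = Z"
      using ex_greatest_extension[OF Z(1)] .
    have "(?A \<union> ?B)\<^sup>+ \<subseteq> noninversions Z"
      using noninversions_antimono Z(2,3)
        trans_biclosed[OF biclosed_noninversions[OF Z(1)] noninversions_subset[OF Z(1)]]
      by (intro trancl_subset_trans) auto
    then have "inversions n u \<subseteq> inversions n m" unfolding u(2) m(2) by blast
    then show ?thesis using Psi_mono[OF u(1) m(1)] u(3) by simp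
  qed
  ultimately show ?thesis
    unfolding greatest_def using Lower_pair[OF X Y] maximal_tubing_Psi[OF m(1)]
    by (auto simp: tubing_order_def)
qed

lemma lattice_tubing_order: "lattice (tubing_order G)"
proof -
  interpret partial_order "tubing_order G" by (rule partial_order_tubing_order)
  show ?thesis
  proof
    fix X Y
    assume X: "X \<in> carrier (tubing_order G)" and Y: "Y \<in> carrier (tubing_order G)"
    show "\<exists>Z. greatest (tubing_order G) Z (Lower (tubing_order G) {X, Y})"
      using ex_tubing_order_meet[OF X Y] .
    have max: "maximal_tubing G X" "maximal_tubing G Y"
      using X Y unfolding tubing_order_def by auto
    \<comment> \<open>Surjectivity of \<open>Psi\<close> lets joins be transported from the weak
      order.\<close>
    obtain v where v: "v permutes {1..n}" "Psi n G v = X"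
      by (rule ex_greatest_extension[OF max(1)])
    obtain w where w: "w permutes {1..n}" "Psi n G w = Y"
      by (rule ex_greatest_extension[OF max(2)])
    have "v \<in> carrier (weak_order n)" "w \<in> carrier (weak_order n)"
      using v w unfolding weak_order_def by auto
    then show "\<exists>Z. least (tubing_order G) Z (Upper (tubing_order G) {X, Y})"
      using ex_weak_order_join least_Psi v(2) w(2) by blast
  qed
qed

text \<open>Joins are choices of a least upper bound; existence makes both choices genuine, and
  uniqueness in the tubing order identifies the two sides.\<close>

lemma Psi_join:
  assumes v: "v \<in> carrier (weak_order n)" and w: "w \<in> carrier (weak_order n)"
  shows "Psi n G (v \<squnion>\<^bsub>weak_order n\<^esub> w) = Psi n G v \<squnion>\<^bsub>tubing_order G\<^esub> Psi n G w"
proof -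
  interpret partial_order "tubing_order G" by (rule partial_order_tubing_order)
  have "least (weak_order n) (v \<squnion>\<^bsub>weak_order n\<^esub> w) (Upper (weak_order n) {v, w})"
    unfolding join_def sup_def using ex_weak_order_join[OF v w] by (rule someI_ex)
  then have *: "least (tubing_order G) (Psi n G (v \<squnion>\<^bsub>weak_order n\<^esub> w))
      (Upper (tubing_order G) {Psi n G v, Psi n G w})"
    by (rule least_Psi[OF v w])
  moreover have "least (tubing_order G) (Psi n G v \<squnion>\<^bsub>tubing_order G\<^esub> Psi n G w)
      (Upper (tubing_order G) {Psi n G v, Psi n G w})"
    unfolding join_def sup_def using * by (rule someI)
  ultimately show ?thesis by (rule least_unique)
qed

end

theorem corollary4p13:
  fixes n :: nat and G :: "nat pair_pre_digraph"
  assumes "pair_graph G" and "pverts G = {1..n}" and "left_filled G"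
  shows "lattice (tubing_order G) \<and>
    Psi n G \<in> carrier (weak_order n) \<rightarrow> carrier (tubing_order G) \<and>
    (\<forall>w \<in> carrier (weak_order n). \<forall>w' \<in> carrier (weak_order n).
       Psi n G (w \<squnion>\<^bsub>weak_order n\<^esub> w') = Psi n G w \<squnion>\<^bsub>tubing_order G\<^esub> Psi n G w')"
proof -
  interpret left_filled_graph_on n G
    using assms by (intro left_filled_graph_on.intro graph_on.intro left_filled_graph_on_axioms.intro)
  have "Psi n G \<in> carrier (weak_order n) \<rightarrow> carrier (tubing_order G)"
    using maximal_tubing_Psi by (auto simp: weak_order_def tubing_order_def)
  then show ?thesis using lattice_tubing_order Psi_join by blast
qed

end
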